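(* Let $\psi\in U\Psi(a,b)$. Then the space $G(\psi)$, with the ordinary (pointwise) linear operations and the norm $\|\cdot\|G(\psi)$, is a Banach space.
   Context: $(X,\Sigma,\mu)$ is a measure space with non-trivial $\sigma$-finite measure $\mu$ such that either $\mu(X)=1$ or $\mu(X)=\infty$, and $\mu$ is diffuse: for every $A\in\Sigma$ with $0<\mu(A)<\infty$ there is $B\subset A$, $B\in\Sigma$, with $\mu(B)=\mu(A)/2$. For measurable $f:X\to\mathbb{R}$ and $p\ge 1$, $|f|_p=\left(\int_X|f|^p\,d\mu\right)^{1/p}$. Functions equal $\mu$-almost everywhere are identified. Let $1\le a<b\le\infty$. $U\Psi=U\Psi(a,b)$ is the set of all continuous functions $\psi:(a,b)\to(0,\infty)$; as a standing assumption, $\psi(a+0)=\infty$ or $\psi(b-0)=\infty$ (or both), where for $b=\infty$ one puts $\psi(b-0)=\lim_{p\to\infty}\psi(p)$. For $\psi\in U\Psi(a,b)$ the space $G(\psi)$ consists of all measurable $f:X\to\mathbb{R}$ with finite norm $\|f\|G(\psi)=\sup_{p\in(a,b)}\left[|f|_p/\psi(p)\right]$. *)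

theory Defs
  imports "HOL-Analysis.Analysis"
begin

locale normed_space_on =
  fixes V :: "'v set"
    and add :: "'v \<Rightarrow> 'v \<Rightarrow> 'v" (infixl "\<oplus>" 65)
    and zero :: 'v ("\<zero>")
    and scale :: "real \<Rightarrow> 'v \<Rightarrow> 'v" (infixr "\<odot>" 75)
    and nrm :: "'v \<Rightarrow> real"
  assumes add_closed: "x \<in> V \<Longrightarrow> y \<in> V \<Longrightarrow> x \<oplus> y \<in> V"
    and zero_closed: "\<zero> \<in> V"
    and scale_closed: "x \<in> V \<Longrightarrow> c \<odot> x \<in> V"
    and add_assoc: "x \<in> V \<Longrightarrow> y \<in> V \<Longrightarrow> z \<in> V \<Longrightarrow> (x \<oplus> y) \<oplus> z = x \<oplus> (y \<oplus> z)"
    and add_commute: "x \<in> V \<Longrightarrow> y \<in> V \<Longrightarrow> x \<oplus> y = y \<oplus> x"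
    and add_zero: "x \<in> V \<Longrightarrow> x \<oplus> \<zero> = x"
    and add_inverse: "x \<in> V \<Longrightarrow> \<exists>y\<in>V. x \<oplus> y = \<zero>"
    and scale_add: "x \<in> V \<Longrightarrow> y \<in> V \<Longrightarrow> c \<odot> (x \<oplus> y) = c \<odot> x \<oplus> c \<odot> y"
    and add_scale: "x \<in> V \<Longrightarrow> (c + d) \<odot> x = c \<odot> x \<oplus> d \<odot> x"
    and scale_scale: "x \<in> V \<Longrightarrow> c \<odot> (d \<odot> x) = (c * d) \<odot> x"
    and scale_one: "x \<in> V \<Longrightarrow> 1 \<odot> x = x"
    and norm_nonneg: "x \<in> V \<Longrightarrow> 0 \<le> nrm x"
    and norm_eq_zero: "x \<in> V \<Longrightarrow> nrm x = 0 \<longleftrightarrow> x = \<zero>"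
    and norm_triangle: "x \<in> V \<Longrightarrow> y \<in> V \<Longrightarrow> nrm (x \<oplus> y) \<le> nrm x + nrm y"
    and norm_scale: "x \<in> V \<Longrightarrow> nrm (c \<odot> x) = \<bar>c\<bar> * nrm x"

locale banach_space_on = normed_space_on +
  assumes complete:
    "\<lbrakk>\<And>n. s n \<in> V; \<And>e. e > 0 \<Longrightarrow> \<exists>N. \<forall>m\<ge>N. \<forall>n\<ge>N. nrm (s m \<oplus> (-1) \<odot> s n) < e\<rbrakk>
      \<Longrightarrow> \<exists>x\<in>V. (\<lambda>n::nat. nrm (s n \<oplus> (-1) \<odot> x)) \<longlonglongrightarrow> 0"

definition diffuse :: "'a measure \<Rightarrow> bool" where
  "diffuse M \<longleftrightarrow> (\<forall>A\<in>sets M. 0 < emeasure M A \<and> emeasure M A < \<infinity> \<longrightarrow>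
     (\<exists>B\<in>sets M. B \<subseteq> A \<and> emeasure M B = emeasure M A / 2))"

definition exponents :: "real \<Rightarrow> ereal \<Rightarrow> real set" where
  "exponents a b = {p. a < p \<and> ereal p < b}"

definition U_Psi :: "real \<Rightarrow> ereal \<Rightarrow> (real \<Rightarrow> real) set" where
  "U_Psi a b = {\<psi>. continuous_on (exponents a b) \<psi> \<and> (\<forall>p\<in>exponents a b. 0 < \<psi> p)}"

definition left_limit_at :: "ereal \<Rightarrow> real filter" where
  "left_limit_at b = (if b = \<infinity> then at_top else at_left (real_of_ereal b))"

definition blows_up :: "real \<Rightarrow> ereal \<Rightarrow> (real \<Rightarrow> real) \<Rightarrow> bool" where
  "blows_up a b \<psi> \<longleftrightarrow>
     filterlim \<psi> at_top (at_right a) \<or> filterlim \<psi> at_top (left_limit_at b)"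

text \<open>Both \<open>|f|\<^sub>p\<close> and the norm are formed in \<open>ennreal\<close>, so that the value \<open>\<infinity>\<close> is retained.\<close>

definition Lp_norm :: "'a measure \<Rightarrow> real \<Rightarrow> ('a \<Rightarrow> real) \<Rightarrow> ennreal" where
  "Lp_norm M p f =
     (let I = \<integral>\<^sup>+x. ennreal (\<bar>f x\<bar> powr p) \<partial>M
      in if I = \<infinity> then \<infinity> else ennreal (enn2real I powr (1 / p)))"

definition G_norm :: "'a measure \<Rightarrow> real \<Rightarrow> ereal \<Rightarrow> (real \<Rightarrow> real) \<Rightarrow> ('a \<Rightarrow> real) \<Rightarrow> ennreal" where
  "G_norm M a b \<psi> f = (SUP p\<in>exponents a b. Lp_norm M p f / ennreal (\<psi> p))"

definition G_funs :: "'a measure \<Rightarrow> real \<Rightarrow> ereal \<Rightarrow> (real \<Rightarrow> real) \<Rightarrow> ('a \<Rightarrow> real) set" where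
  "G_funs M a b \<psi> = {f \<in> borel_measurable M. G_norm M a b \<psi> f < \<infinity>}"

definition ae_rel :: "'a measure \<Rightarrow> (('a \<Rightarrow> real) \<times> ('a \<Rightarrow> real)) set" where
  "ae_rel M = {(f, g). f \<in> borel_measurable M \<and> g \<in> borel_measurable M \<and> (AE x in M. f x = g x)}"

definition G_space ::
  "'a measure \<Rightarrow> real \<Rightarrow> ereal \<Rightarrow> (real \<Rightarrow> real) \<Rightarrow> ('a \<Rightarrow> real) set set" where
  "G_space M a b \<psi> = G_funs M a b \<psi> // ae_rel M"

definition class_add ::
  "'a measure \<Rightarrow> ('a \<Rightarrow> real) set \<Rightarrow> ('a \<Rightarrow> real) set \<Rightarrow> ('a \<Rightarrow> real) set" where
  "class_add M F H = (\<Union>f\<in>F. \<Union>h\<in>H. ae_rel M `` {\<lambda>x. f x + h x})"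

definition class_zero :: "'a measure \<Rightarrow> ('a \<Rightarrow> real) set" where
  "class_zero M = ae_rel M `` {\<lambda>x. 0}"

definition class_scale :: "'a measure \<Rightarrow> real \<Rightarrow> ('a \<Rightarrow> real) set \<Rightarrow> ('a \<Rightarrow> real) set" where
  "class_scale M c F = (\<Union>f\<in>F. ae_rel M `` {\<lambda>x. c * f x})"

definition class_norm ::
  "'a measure \<Rightarrow> real \<Rightarrow> ereal \<Rightarrow> (real \<Rightarrow> real) \<Rightarrow> ('a \<Rightarrow> real) set \<Rightarrow> real" where
  "class_norm M a b \<psi> F = the_elem ((\<lambda>f. enn2real (G_norm M a b \<psi> f)) ` F)"

text \<open>The operations and the norm on classes do not depend on the chosen representatives.\<close>

lemma equiv_ae_rel: "equiv (borel_measurable M) (ae_rel M)"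
proof (rule equivI)
  show "ae_rel M \<subseteq> borel_measurable M \<times> borel_measurable M"
    by (auto simp: ae_rel_def)
  show "refl_on (borel_measurable M) (ae_rel M)"
    by (auto simp: ae_rel_def refl_on_def)
  show "sym (ae_rel M)"
    by (auto simp: ae_rel_def sym_def eq_commute)
  show "trans (ae_rel M)"
  proof (rule transI)
    fix f g h assume fg: "(f, g) \<in> ae_rel M" and gh: "(g, h) \<in> ae_rel M"
    have "AE x in M. f x = g x" "AE x in M. g x = h x" using fg gh by (auto simp: ae_rel_def)
    then have "AE x in M. f x = h x" by eventually_elim simp
    then show "(f, h) \<in> ae_rel M" using fg gh by (simp add: ae_rel_def)
  qed
qed

lemma class_add_eq:
  assumes [measurable]: "f \<in> borel_measurable M" "h \<in> borel_measurable M"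
  shows "class_add M (ae_rel M `` {f}) (ae_rel M `` {h}) = ae_rel M `` {\<lambda>x. f x + h x}"
proof -
  have "ae_rel M `` {\<lambda>x. f' x + h' x} = ae_rel M `` {\<lambda>x. f x + h x}"
    if "(f, f') \<in> ae_rel M" "(h, h') \<in> ae_rel M" for f' h'
  proof (rule equiv_class_eq[OF equiv_ae_rel])
    show "(\<lambda>x. f' x + h' x, \<lambda>x. f x + h x) \<in> ae_rel M"
    proof -
      have m [measurable]: "f' \<in> borel_measurable M" "h' \<in> borel_measurable M"
        using that by (simp_all add: ae_rel_def)
      have "AE x in M. f x = f' x" "AE x in M. h x = h' x" using that by (simp_all add: ae_rel_def)
      then have "AE x in M. f' x + h' x = f x + h x" by eventually_elim simp
      then show ?thesis by (simp add: ae_rel_def)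
    qed
  qed
  moreover have "(f, f) \<in> ae_rel M" "(h, h) \<in> ae_rel M"
    by (auto simp: ae_rel_def)
  ultimately show ?thesis unfolding class_add_def by fast
qed

lemma class_scale_eq:
  assumes [measurable]: "f \<in> borel_measurable M"
  shows "class_scale M c (ae_rel M `` {f}) = ae_rel M `` {\<lambda>x. c * f x}"
proof -
  have "ae_rel M `` {\<lambda>x. c * f' x} = ae_rel M `` {\<lambda>x. c * f x}"
    if "(f, f') \<in> ae_rel M" for f'
  proof (rule equiv_class_eq[OF equiv_ae_rel])
    show "(\<lambda>x. c * f' x, \<lambda>x. c * f x) \<in> ae_rel M"
    proof -
      have m [measurable]: "f' \<in> borel_measurable M"
        using that by (simp add: ae_rel_def)
      have "AE x in M. f x = f' x" using that by (simp add: ae_rel_def)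
      then have "AE x in M. c * f' x = c * f x" by eventually_elim simp
      then show ?thesis by (simp add: ae_rel_def)
    qed
  qed
  moreover have "(f, f) \<in> ae_rel M" by (auto simp: ae_rel_def)
  ultimately show ?thesis unfolding class_scale_def by blast
qed

lemma G_norm_cong_AE:
  assumes "(f, g) \<in> ae_rel M"
  shows "G_norm M a b \<psi> f = G_norm M a b \<psi> g"
proof -
  have "(\<integral>\<^sup>+x. ennreal (\<bar>f x\<bar> powr p) \<partial>M) = (\<integral>\<^sup>+x. ennreal (\<bar>g x\<bar> powr p) \<partial>M)" for p
  proof (rule nn_integral_cong_AE)
    have "AE x in M. f x = g x" using assms by (simp add: ae_rel_def)
    then show "AE x in M. ennreal (\<bar>f x\<bar> powr p) = ennreal (\<bar>g x\<bar> powr p)"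
      by eventually_elim simp
  qed
  then show ?thesis by (simp add: G_norm_def Lp_norm_def)
qed

lemma class_norm_eq:
  assumes "f \<in> borel_measurable M"
  shows "class_norm M a b \<psi> (ae_rel M `` {f}) = enn2real (G_norm M a b \<psi> f)"
proof -
  have "(f, f) \<in> ae_rel M" using assms by (auto simp: ae_rel_def)
  then have "(\<lambda>f. enn2real (G_norm M a b \<psi> f)) ` (ae_rel M `` {f}) = {enn2real (G_norm M a b \<psi> f)}"
    by (intro equalityI subsetI) (fastforce dest: G_norm_cong_AE[of f _ M a b \<psi>])+
  then show ?thesis by (simp add: class_norm_def)
qed

end

theory Submission
  imports Defs
begin

text \<open>
  The key is that \<open>\<parallel>f\<parallel> \<le> c\<close> says no more and no less than
  \<open>\<integral>|f|\<^sup>p \<le> (c \<psi>(p))\<^sup>p\<close> for every \<open>p\<close> in \<open>(a, b)\<close>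
  (\<open>G_norm_le_iff\<close>). Since \<open>\<psi>\<close> is positive and finite on \<open>(a, b)\<close>, each property of
  the norm thereby becomes a property of the single integrals \<open>\<integral>|f|\<^sup>p\<close>, read off
  for all \<open>p\<close> with the same constant \<open>c\<close>.

  Because \<open>p \<ge> a \<ge> 1\<close>, convexity of \<open>x \<mapsto> x\<^sup>p\<close> gives the triangle inequality
  (\<open>nn_integral_powr_add_le\<close>). Homogeneity holds for each \<open>p\<close>, and the norm vanishes only on
  null functions because \<open>(a, b)\<close> contains at least one exponent.

  For completeness, a Cauchy sequence \<open>f\<^sub>n\<close> is Cauchy in \<open>L\<^sub>q\<close> for one arbitrarily
  chosen exponent \<open>q\<close>, so that a subsequence converges almost everywhere to some \<open>g\<close>
  (\<open>AE_convergent_of_powr_small\<close>). This \<open>g\<close> does not depend on \<open>p\<close>, and Fatou's lemma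
  carries the bound \<open>\<integral>|f\<^sub>n - f\<^sub>m|\<^sup>p \<le> (\<epsilon> \<psi>(p))\<^sup>p\<close> over to
  \<open>f\<^sub>n - g\<close> for every \<open>p\<close> in \<open>(a, b)\<close>
  (\<open>G_funs_Cauchy_imp_limit\<close>). The index from which the bound holds is the same for all
  \<open>p\<close>, and this is convergence in the norm.
\<close>

section \<open>Minkowski's inequality in modular form\<close>

text \<open>
  Convexity of \<open>x \<mapsto> x\<^sup>p\<close> up to the endpoint \<open>0\<close>, which the open half-line of
  \<open>powr_convex\<close> leaves out. There the claim reduces to \<open>l\<^sup>p \<le> l\<close> for
  \<open>l\<close> in \<open>[0, 1]\<close>.
\<close>

lemma powr_convex_combination:
  fixes x y l m p :: real
  assumes "1 \<le> p" "0 \<le> x" "0 \<le> y" "0 \<le> l" "0 \<le> m" "l + m = 1"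
  shows "(l * x + m * y) powr p \<le> l * x powr p + m * y powr p"
proof -
  have le: "l powr p \<le> l" "m powr p \<le> m"
    using assms powr_mono'[of 1 p l] powr_mono'[of 1 p m] by simp_all
  consider "x = 0" | "y = 0" | "0 < x" "0 < y" using assms by linarith
  then show ?thesis
  proof cases
    case 1
    then show ?thesis using le assms by (simp add: powr_mult mult_right_mono)
  next
    case 2
    then show ?thesis using le assms by (simp add: powr_mult mult_right_mono)
  next
    case 3
    have l: "l = 1 - m" using assms by simp
    show ?thesis
      using convex_onD[OF powr_convex[OF assms(1)], of m x y] 3 assms unfolding l by simp
  qed
qed

text \<open>
  Minkowski's inequality, with norms replaced by upper bounds \<open>s\<close> and \<open>t\<close>. Writing
  \<open>|f| + |g| = (s + t) (s/(s + t) \<cdot> |f|/s + t/(s + t) \<cdot> |g|/t)\<close>, convexity bounds the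
  \<open>p\<close>-th power by a combination of \<open>(|f|/s)\<^sup>p\<close> and \<open>(|g|/t)\<^sup>p\<close>, both of
  integral at most \<open>1\<close>. Strict positivity of \<open>s\<close> and \<open>t\<close> avoids normalising a null
  function.
\<close>

lemma nn_integral_powr_add_le:
  assumes p: "1 \<le> p" and s: "0 < s" and t: "0 < t"
    and f [measurable]: "f \<in> borel_measurable M"
    and g [measurable]: "g \<in> borel_measurable M"
    and F: "(\<integral>\<^sup>+x. ennreal (\<bar>f x\<bar> powr p) \<partial>M) \<le> ennreal (s powr p)"
    and G: "(\<integral>\<^sup>+x. ennreal (\<bar>g x\<bar> powr p) \<partial>M) \<le> ennreal (t powr p)"
  shows "(\<integral>\<^sup>+x. ennreal (\<bar>f x + g x\<bar> powr p) \<partial>M) \<le> ennreal ((s + t) powr p)"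
proof -
  define A where "A = (s + t) powr p * (s / (s + t)) / s powr p"
  define B where "B = (s + t) powr p * (t / (s + t)) / t powr p"
  have AB: "0 \<le> A" "0 \<le> B" using s t by (simp_all add: A_def B_def)
  have "\<bar>f x + g x\<bar> powr p \<le> A * \<bar>f x\<bar> powr p + B * \<bar>g x\<bar> powr p" for x
  proof -
    have "\<bar>f x + g x\<bar> powr p \<le> (\<bar>f x\<bar> + \<bar>g x\<bar>) powr p"
      using p by (intro powr_mono2) auto
    also have "\<bar>f x\<bar> + \<bar>g x\<bar> =
        (s + t) * (s / (s + t) * (\<bar>f x\<bar> / s) + t / (s + t) * (\<bar>g x\<bar> / t))"
      using s t by (simp add: distrib_left)
    also have "\<dots> powr p = (s + t) powr p *
        (s / (s + t) * (\<bar>f x\<bar> / s) + t / (s + t) * (\<bar>g x\<bar> / t)) powr p"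
      by (rule powr_mult)
    also have "\<dots> \<le> (s + t) powr p *
        (s / (s + t) * (\<bar>f x\<bar> / s) powr p + t / (s + t) * (\<bar>g x\<bar> / t) powr p)"
      using p s t by (intro mult_left_mono powr_convex_combination)
        (auto simp: add_divide_distrib[symmetric])
    also have "\<dots> = A * \<bar>f x\<bar> powr p + B * \<bar>g x\<bar> powr p"
      using s t by (simp add: A_def B_def powr_divide distrib_left)
    finally show ?thesis .
  qed
  then have "(\<integral>\<^sup>+x. ennreal (\<bar>f x + g x\<bar> powr p) \<partial>M) \<le>
      (\<integral>\<^sup>+x. ennreal A * ennreal (\<bar>f x\<bar> powr p) + ennreal B * ennreal (\<bar>g x\<bar> powr p) \<partial>M)"
    using AB by (intro nn_integral_mono)
      (simp add: ennreal_mult[symmetric] ennreal_plus[symmetric] del: ennreal_plus)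
  also have "\<dots> = ennreal A * (\<integral>\<^sup>+x. ennreal (\<bar>f x\<bar> powr p) \<partial>M) +
      ennreal B * (\<integral>\<^sup>+x. ennreal (\<bar>g x\<bar> powr p) \<partial>M)"
    by (simp add: nn_integral_add nn_integral_cmult)
  also have "\<dots> \<le> ennreal A * ennreal (s powr p) + ennreal B * ennreal (t powr p)"
    using F G by (intro add_mono mult_left_mono) auto
  also have "\<dots> = ennreal (A * s powr p + B * t powr p)"
    using AB by (simp add: ennreal_mult)
  also have "A * s powr p + B * t powr p = (s + t) powr p * (s / (s + t) + t / (s + t))"
    using s t by (simp add: A_def B_def distrib_left)
  also have "\<dots> = (s + t) powr p"
    using s t by (simp add: add_divide_distrib[symmetric])
  finally show ?thesis .
qed

section \<open>The norm and its modular description\<close>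

lemma Lp_norm_le_iff:
  assumes "0 < p" "0 \<le> c"
  shows "Lp_norm M p f \<le> ennreal c \<longleftrightarrow>
    (\<integral>\<^sup>+x. ennreal (\<bar>f x\<bar> powr p) \<partial>M) \<le> ennreal (c powr p)"
proof (cases "(\<integral>\<^sup>+x. ennreal (\<bar>f x\<bar> powr p) \<partial>M)")
  case (real r)
  have "r powr (1 / p) \<le> c \<longleftrightarrow> r \<le> c powr p"
    using assms real(1) powr_mono2[of p "r powr (1 / p)" c] powr_mono2[of "1 / p" r "c powr p"]
    by (auto simp: powr_powr)
  then show ?thesis using real assms by (simp add: Lp_norm_def)
next
  case top
  then show ?thesis by (simp add: Lp_norm_def top_unique)
qed

lemma exponents_ge_one: "1 \<le> a \<Longrightarrow> p \<in> exponents a b \<Longrightarrow> 1 \<le> p"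
  by (simp add: exponents_def)

lemma exponents_nonempty:
  assumes "ereal a < b"
  obtains p where "p \<in> exponents a b"
  using ereal_dense2[OF assms] by (auto simp: exponents_def)

text \<open>
  All later arguments see the norm through this equivalence only: no suprema and no
  \<open>p\<close>-th roots occur any more.
\<close>

lemma G_norm_le_iff:
  assumes "1 \<le> a" "\<psi> \<in> U_Psi a b" "0 \<le> c"
  shows "G_norm M a b \<psi> f \<le> ennreal c \<longleftrightarrow> (\<forall>p\<in>exponents a b.
    (\<integral>\<^sup>+x. ennreal (\<bar>f x\<bar> powr p) \<partial>M) \<le> ennreal ((c * \<psi> p) powr p))"
proof -
  have "Lp_norm M p f / ennreal (\<psi> p) \<le> ennreal c \<longleftrightarrow>
      (\<integral>\<^sup>+x. ennreal (\<bar>f x\<bar> powr p) \<partial>M) \<le> ennreal ((c * \<psi> p) powr p)"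
    if p: "p \<in> exponents a b" for p
  proof -
    have pos: "0 < \<psi> p" "0 < p"
      using p assms exponents_ge_one[OF assms(1) p] by (auto simp: U_Psi_def)
    have "Lp_norm M p f / ennreal (\<psi> p) \<le> ennreal c \<longleftrightarrow> Lp_norm M p f \<le> ennreal (c * \<psi> p)"
    proof (cases "Lp_norm M p f")
      case (real r)
      then show ?thesis using pos assms by (simp add: divide_ennreal pos_divide_le_eq)
    next
      case top
      then show ?thesis using pos by (simp add: ennreal_top_divide top_unique)
    qed
    then show ?thesis using pos assms by (simp add: Lp_norm_le_iff)
  qed
  then show ?thesis by (auto simp: G_norm_def SUP_le_iff)
qed

lemma G_norm_eq_zero_iff:
  assumes "1 \<le> a" "ereal a < b" "\<psi> \<in> U_Psi a b"
    and [measurable]: "f \<in> borel_measurable M"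
  shows "G_norm M a b \<psi> f = 0 \<longleftrightarrow> (AE x in M. f x = 0)"
proof -
  obtain p where p: "p \<in> exponents a b" using exponents_nonempty[OF assms(2)] .
  have "G_norm M a b \<psi> f = 0 \<longleftrightarrow>
      (\<forall>p\<in>exponents a b. (\<integral>\<^sup>+x. ennreal (\<bar>f x\<bar> powr p) \<partial>M) = 0)"
    using G_norm_le_iff[OF assms(1,3), of 0 M f] by simp
  also have "\<dots> \<longleftrightarrow> (\<forall>p\<in>exponents a b. AE x in M. f x = 0)"
    by (simp add: nn_integral_0_iff_AE ennreal_eq_0_iff)
  finally show ?thesis using p by blast
qed

text \<open>
  Both norms are enlarged by \<open>e/2\<close>, as the modular Minkowski inequality asks for positive
  bounds; then \<open>e\<close> tends to \<open>0\<close>.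
\<close>

lemma G_norm_add_le:
  assumes a: "1 \<le> a" and \<psi>: "\<psi> \<in> U_Psi a b"
    and f [measurable]: "f \<in> borel_measurable M"
    and g [measurable]: "g \<in> borel_measurable M"
  shows "G_norm M a b \<psi> (\<lambda>x. f x + g x) \<le> G_norm M a b \<psi> f + G_norm M a b \<psi> g"
proof (cases "G_norm M a b \<psi> f = top \<or> G_norm M a b \<psi> g = top")
  case True
  then show ?thesis by auto
next
  case False
  then obtain c d where c: "G_norm M a b \<psi> f = ennreal c" "0 \<le> c"
    and d: "G_norm M a b \<psi> g = ennreal d" "0 \<le> d"
    by (metis ennreal_cases)
  have "G_norm M a b \<psi> (\<lambda>x. f x + g x) \<le> ennreal (c + d) + ennreal e" if e: "0 < e" for e
  proof -
    define c' d' where "c' = c + e / 2" and "d' = d + e / 2"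
    have pos: "0 < c'" "0 < d'" using c d e by (simp_all add: c'_def d'_def)
    have "G_norm M a b \<psi> (\<lambda>x. f x + g x) \<le> ennreal (c' + d')"
      unfolding G_norm_le_iff[OF a \<psi> add_nonneg_nonneg[OF less_imp_le less_imp_le, OF pos]]
    proof
      fix p assume p: "p \<in> exponents a b"
      have \<psi>p: "0 < \<psi> p" using p \<psi> by (simp add: U_Psi_def)
      have "G_norm M a b \<psi> f \<le> ennreal c'" "G_norm M a b \<psi> g \<le> ennreal d'"
        using c d e by (simp_all add: c'_def d'_def)
      then have "(\<integral>\<^sup>+x. ennreal (\<bar>f x\<bar> powr p) \<partial>M) \<le> ennreal ((c' * \<psi> p) powr p)"
        "(\<integral>\<^sup>+x. ennreal (\<bar>g x\<bar> powr p) \<partial>M) \<le> ennreal ((d' * \<psi> p) powr p)"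
        using p pos by (simp_all add: G_norm_le_iff[OF a \<psi>])
      then show "(\<integral>\<^sup>+x. ennreal (\<bar>f x + g x\<bar> powr p) \<partial>M) \<le> ennreal (((c' + d') * \<psi> p) powr p)"
        unfolding distrib_right
        by (intro nn_integral_powr_add_le[OF exponents_ge_one[OF a p] _ _ f g]
          mult_pos_pos pos \<psi>p)
    qed
    also have "ennreal (c' + d') = ennreal (c + d) + ennreal e"
      using c d e by (simp add: c'_def d'_def flip: ennreal_plus)
    finally show ?thesis .
  qed
  then have "G_norm M a b \<psi> (\<lambda>x. f x + g x) \<le> ennreal (c + d)"
    by (rule ennreal_le_epsilon)
  then show ?thesis using c d by simp
qed

lemma G_norm_scale_le:
  assumes a: "1 \<le> a" and \<psi>: "\<psi> \<in> U_Psi a b"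
    and f [measurable]: "f \<in> borel_measurable M" and fin: "G_norm M a b \<psi> f = ennreal t" "0 \<le> t"
  shows "G_norm M a b \<psi> (\<lambda>x. c * f x) \<le> ennreal (\<bar>c\<bar> * t)"
proof -
  have nonneg: "0 \<le> \<bar>c\<bar> * t" using fin by simp
  show ?thesis
    unfolding G_norm_le_iff[OF a \<psi> nonneg]
  proof
    fix p assume p: "p \<in> exponents a b"
    have "(\<integral>\<^sup>+x. ennreal (\<bar>c * f x\<bar> powr p) \<partial>M)
        = ennreal (\<bar>c\<bar> powr p) * (\<integral>\<^sup>+x. ennreal (\<bar>f x\<bar> powr p) \<partial>M)"
      by (simp add: abs_mult powr_mult ennreal_mult nn_integral_cmult)
    also have "\<dots> \<le> ennreal (\<bar>c\<bar> powr p) * ennreal ((t * \<psi> p) powr p)"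
      using G_norm_le_iff[OF a \<psi> fin(2), of M f] fin p by (intro mult_left_mono) auto
    also have "\<dots> = ennreal ((\<bar>c\<bar> * t * \<psi> p) powr p)"
      by (simp add: ennreal_mult[symmetric] powr_mult[symmetric] mult.assoc)
    finally show "(\<integral>\<^sup>+x. ennreal (\<bar>c * f x\<bar> powr p) \<partial>M) \<le> ennreal ((\<bar>c\<bar> * t * \<psi> p) powr p)" .
  qed
qed

section \<open>The linear space of functions of finite norm\<close>

lemma G_funs_norm_le_iff:
  assumes "f \<in> G_funs M a b \<psi>" "0 \<le> c"
  shows "enn2real (G_norm M a b \<psi> f) \<le> c \<longleftrightarrow> G_norm M a b \<psi> f \<le> ennreal c"
  using assms by (cases "G_norm M a b \<psi> f") (auto simp: G_funs_def)

lemma G_funs_add: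
  assumes "1 \<le> a" "\<psi> \<in> U_Psi a b" "f \<in> G_funs M a b \<psi>" "g \<in> G_funs M a b \<psi>"
  shows "(\<lambda>x. f x + g x) \<in> G_funs M a b \<psi>"
    and "enn2real (G_norm M a b \<psi> (\<lambda>x. f x + g x)) \<le>
      enn2real (G_norm M a b \<psi> f) + enn2real (G_norm M a b \<psi> g)"
proof -
  have le: "G_norm M a b \<psi> (\<lambda>x. f x + g x) \<le> G_norm M a b \<psi> f + G_norm M a b \<psi> g"
    using assms by (intro G_norm_add_le) (auto simp: G_funs_def)
  have fin: "G_norm M a b \<psi> f + G_norm M a b \<psi> g < \<infinity>"
    using assms by (simp add: G_funs_def)
  show G: "(\<lambda>x. f x + g x) \<in> G_funs M a b \<psi>"
    using assms le_less_trans[OF le fin] by (auto simp: G_funs_def)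
  show "enn2real (G_norm M a b \<psi> (\<lambda>x. f x + g x)) \<le>
      enn2real (G_norm M a b \<psi> f) + enn2real (G_norm M a b \<psi> g)"
    using le assms by (subst G_funs_norm_le_iff[OF G]) (auto simp: G_funs_def)
qed

text \<open>
  Only the upper bound on the norm of a multiple is proved directly; the lower bound follows by
  scaling back with \<open>1/c\<close>.
\<close>

lemma G_funs_scale:
  assumes a: "1 \<le> a" and \<psi>: "\<psi> \<in> U_Psi a b" and f: "f \<in> G_funs M a b \<psi>"
  shows "(\<lambda>x. c * f x) \<in> G_funs M a b \<psi>"
    and "enn2real (G_norm M a b \<psi> (\<lambda>x. c * f x)) = \<bar>c\<bar> * enn2real (G_norm M a b \<psi> f)"
proof -
  have G: "(\<lambda>x. c * f x) \<in> G_funs M a b \<psi> \<and>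
      enn2real (G_norm M a b \<psi> (\<lambda>x. c * f x)) \<le> \<bar>c\<bar> * enn2real (G_norm M a b \<psi> f)"
    if f: "f \<in> G_funs M a b \<psi>" for c f
  proof -
    have le: "G_norm M a b \<psi> (\<lambda>x. c * f x) \<le> ennreal (\<bar>c\<bar> * enn2real (G_norm M a b \<psi> f))"
      using f by (intro G_norm_scale_le[OF a \<psi>]) (simp_all add: G_funs_def)
    have "G_norm M a b \<psi> (\<lambda>x. c * f x) < \<infinity>"
      using le_less_trans[OF le ennreal_less_top] by simp
    then show ?thesis using f enn2real_leI[OF _ le] by (auto simp: G_funs_def)
  qed
  show "(\<lambda>x. c * f x) \<in> G_funs M a b \<psi>" using G[OF f] by blast
  show "enn2real (G_norm M a b \<psi> (\<lambda>x. c * f x)) = \<bar>c\<bar> * enn2real (G_norm M a b \<psi> f)"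
  proof (cases "c = 0")
    case True
    then show ?thesis using G[OF f, of 0] by (simp add: order_antisym)
  next
    case False
    have "enn2real (G_norm M a b \<psi> (\<lambda>x. inverse c * (c * f x))) \<le>
        \<bar>inverse c\<bar> * enn2real (G_norm M a b \<psi> (\<lambda>x. c * f x))"
      using G[of "\<lambda>x. c * f x" "inverse c"] G[OF f, of c] by blast
    then have "enn2real (G_norm M a b \<psi> f) \<le>
        enn2real (G_norm M a b \<psi> (\<lambda>x. c * f x)) / \<bar>c\<bar>"
      using False by (simp add: mult.assoc[symmetric] inverse_eq_divide)
    then have "\<bar>c\<bar> * enn2real (G_norm M a b \<psi> f) \<le> enn2real (G_norm M a b \<psi> (\<lambda>x. c * f x))"
      using False by (simp add: pos_le_divide_eq mult.commute[of "\<bar>c\<bar>"])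
    then show ?thesis using G[OF f, of c] by linarith
  qed
qed

lemma G_funs_zero:
  assumes "1 \<le> a" "ereal a < b" "\<psi> \<in> U_Psi a b"
  shows "(\<lambda>x. 0) \<in> G_funs M a b \<psi>"
  using G_norm_eq_zero_iff[OF assms, of "\<lambda>x. 0" M] by (simp add: G_funs_def)

lemma G_funs_diff:
  assumes "1 \<le> a" "\<psi> \<in> U_Psi a b" "f \<in> G_funs M a b \<psi>" "g \<in> G_funs M a b \<psi>"
  shows "(\<lambda>x. f x - g x) \<in> G_funs M a b \<psi>"
  using G_funs_add(1)[OF assms(1-3) G_funs_scale(1)[OF assms(1,2,4), of "-1"]] by simp

section \<open>Completeness\<close>

text \<open>
  Riesz's subsequence argument. By Markov's inequality the \<open>k\<close>-th increment exceeds
  \<open>2\<^sup>-\<^sup>k\<close> on a set of measure at most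
  \<open>(2\<^sup>k)\<^sup>p (4\<^sup>-\<^sup>k)\<^sup>p \<le> 2\<^sup>-\<^sup>k\<close>. These measures are summable, so by
  Borel--Cantelli almost every point has increments dominated from some index on by a geometric
  series.
\<close>

lemma AE_convergent_of_powr_small:
  fixes h :: "nat \<Rightarrow> 'a \<Rightarrow> real"
  assumes p: "1 \<le> p" and h [measurable]: "\<And>k. h k \<in> borel_measurable M"
    and small: "\<And>k. (\<integral>\<^sup>+x. ennreal (\<bar>h (Suc k) x - h k x\<bar> powr p) \<partial>M) \<le>
      ennreal (((1/4) ^ k) powr p)"
  shows "AE x in M. convergent (\<lambda>k. h k x)"
proof -
  define A where "A k = {x \<in> space M. (1/2) ^ k \<le> \<bar>h (Suc k) x - h k x\<bar>}" for k
  have A [measurable]: "A k \<in> sets M" for k by (simp add: A_def)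
  have em: "emeasure M (A k) \<le> ennreal ((1/2) ^ k)" for k
  proof -
    have "indicator (A k) x \<le> ennreal ((2 ^ k) powr p) * ennreal (\<bar>h (Suc k) x - h k x\<bar> powr p)" for x
    proof (cases "x \<in> A k")
      case True
      then have "1 \<le> 2 ^ k * \<bar>h (Suc k) x - h k x\<bar>"
        by (simp add: A_def power_one_over field_simps)
      then have "1 \<le> (2 ^ k * \<bar>h (Suc k) x - h k x\<bar>) powr p"
        using p by (simp add: ge_one_powr_ge_zero)
      then show ?thesis using True by (simp add: ennreal_mult[symmetric] powr_mult)
    qed simp
    then have "(\<integral>\<^sup>+x. indicator (A k) x \<partial>M) \<le>
        (\<integral>\<^sup>+x. ennreal ((2 ^ k) powr p) * ennreal (\<bar>h (Suc k) x - h k x\<bar> powr p) \<partial>M)"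
      by (intro nn_integral_mono)
    then have "emeasure M (A k) \<le>
        ennreal ((2 ^ k) powr p) * (\<integral>\<^sup>+x. ennreal (\<bar>h (Suc k) x - h k x\<bar> powr p) \<partial>M)"
      by (simp add: nn_integral_cmult)
    also have "\<dots> \<le> ennreal ((2 ^ k) powr p) * ennreal (((1/4) ^ k) powr p)"
      by (intro mult_left_mono small) simp
    also have "\<dots> = ennreal (((1/2) ^ k) powr p)"
      by (simp add: ennreal_mult[symmetric] powr_mult[symmetric] power_mult_distrib[symmetric])
    also have "\<dots> \<le> ennreal ((1/2) ^ k)"
      using powr_mono'[OF p, of "(1/2) ^ k"] by (simp add: power_le_one)
    finally show ?thesis .
  qed
  have "AE x in M. eventually (\<lambda>k. x \<in> space M - A k) sequentially"
  proof (rule borel_cantelli_AE1)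
    show "emeasure M (A k) < \<infinity>" for k
      using le_less_trans[OF em[of k]] by simp
    have "measure M (A k) \<le> (1/2) ^ k" for k
      using em[of k] by (simp add: measure_def enn2real_leI)
    then show "summable (\<lambda>k. measure M (A k))"
      by (intro summable_comparison_test[OF _ summable_geometric[of "1/2 :: real"]]) auto
  qed simp
  then show ?thesis
  proof eventually_elim
    case (elim x)
    then have "eventually (\<lambda>k. norm (h (Suc k) x - h k x) \<le> (1/2) ^ k) sequentially"
      by eventually_elim (auto simp: A_def)
    then have "summable (\<lambda>k. h (Suc k) x - h k x)"
      by (rule summable_comparison_test_ev) (simp add: summable_geometric)
    then have "convergent (\<lambda>n. \<Sum>k<n. h (Suc k) x - h k x)"
      by (simp add: summable_iff_convergent)
    then have "convergent (\<lambda>n. h n x - h 0 x)"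
      by (simp only: sum_lessThan_telescope[of "\<lambda>k. h k x"])
    then show ?case
      using convergent_add[OF _ convergent_const[of "h 0 x"]] by fastforce
  qed
qed

text \<open>
  The pointwise limit \<open>g\<close> is found with a single exponent \<open>q\<close>; the Cauchy condition,
  whose index serves all exponents at once, then makes the convergence uniform in \<open>p\<close>.
\<close>

lemma G_funs_Cauchy_imp_limit:
  fixes f :: "nat \<Rightarrow> 'a \<Rightarrow> real"
  assumes a: "1 \<le> a" and ab: "ereal a < b" and \<psi>: "\<psi> \<in> U_Psi a b"
    and f: "\<And>n. f n \<in> G_funs M a b \<psi>"
    and Cauchy: "\<And>e. e > 0 \<Longrightarrow>
      \<exists>N. \<forall>m\<ge>N. \<forall>n\<ge>N. enn2real (G_norm M a b \<psi> (\<lambda>x. f m x - f n x)) < e"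
  obtains g where "g \<in> G_funs M a b \<psi>"
    and "(\<lambda>n. enn2real (G_norm M a b \<psi> (\<lambda>x. f n x - g x))) \<longlonglongrightarrow> 0"
proof -
  have meas [measurable]: "f n \<in> borel_measurable M" for n
    using f by (simp add: G_funs_def)
  \<comment> \<open>The index is independent of \<open>p\<close>: here the supremum in the norm pays off.\<close>
  have modular: "\<exists>N. \<forall>m\<ge>N. \<forall>n\<ge>N. \<forall>p\<in>exponents a b.
      (\<integral>\<^sup>+x. ennreal (\<bar>f m x - f n x\<bar> powr p) \<partial>M) \<le> ennreal ((e * \<psi> p) powr p)"
    if e: "0 < e" for e
  proof -
    obtain N where N: "\<And>m n. m \<ge> N \<Longrightarrow> n \<ge> N \<Longrightarrow>
        enn2real (G_norm M a b \<psi> (\<lambda>x. f m x - f n x)) < e"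
      using Cauchy[OF e] by blast
    have "G_norm M a b \<psi> (\<lambda>x. f m x - f n x) \<le> ennreal e" if "m \<ge> N" "n \<ge> N" for m n
      using N[OF that] e G_funs_norm_le_iff[OF G_funs_diff[OF a \<psi> f[of m] f[of n]], of e] by simp
    then show ?thesis using e by (auto simp: G_norm_le_iff[OF a \<psi>])
  qed
  obtain q where q: "q \<in> exponents a b" using exponents_nonempty[OF ab] .
  have \<psi>q: "0 < \<psi> q" using q \<psi> by (simp add: U_Psi_def)
  have "\<exists>N. \<forall>m\<ge>N. \<forall>n\<ge>N.
      (\<integral>\<^sup>+x. ennreal (\<bar>f m x - f n x\<bar> powr q) \<partial>M) \<le> ennreal (((1/4) ^ k) powr q)" for k
    using modular[of "(1/4) ^ k / \<psi> q"] q \<psi>q by fastforce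
  then obtain N where N: "\<And>k m n. m \<ge> N k \<Longrightarrow> n \<ge> N k \<Longrightarrow>
      (\<integral>\<^sup>+x. ennreal (\<bar>f m x - f n x\<bar> powr q) \<partial>M) \<le> ennreal (((1/4) ^ k) powr q)"
    by metis
  \<comment> \<open>A monotone choice of indices, so that \<open>r (Suc k)\<close> also lies above \<open>N k\<close>; the summand
    \<open>k\<close> makes \<open>r\<close> tend to infinity.\<close>
  define r where "r k = k + (\<Sum>i\<le>k. N i)" for k
  have r: "N k \<le> r k" "N k \<le> r (Suc k)" "k \<le> r k" for k
    using member_le_sum[of k "{..k}" N] by (auto simp: r_def)
  define g where "g x = lim (\<lambda>k. f (r k) x)" for x
  have g [measurable]: "g \<in> borel_measurable M"
    unfolding g_def by measurable
  have "AE x in M. convergent (\<lambda>k. f (r k) x)"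
    by (rule AE_convergent_of_powr_small[OF exponents_ge_one[OF a q]]) (auto intro: N r)
  then have lim: "AE x in M. (\<lambda>k. f (r k) x) \<longlonglongrightarrow> g x"
    by eventually_elim (simp add: g_def convergent_LIMSEQ_iff)
  have close: "\<exists>N. \<forall>n\<ge>N. G_norm M a b \<psi> (\<lambda>x. f n x - g x) \<le> ennreal e" if e: "0 < e" for e
  proof -
    obtain K where K: "\<And>m n p. m \<ge> K \<Longrightarrow> n \<ge> K \<Longrightarrow> p \<in> exponents a b \<Longrightarrow>
        (\<integral>\<^sup>+x. ennreal (\<bar>f m x - f n x\<bar> powr p) \<partial>M) \<le> ennreal ((e * \<psi> p) powr p)"
      using modular[OF e] by blast
    have "(\<integral>\<^sup>+x. ennreal (\<bar>f n x - g x\<bar> powr p) \<partial>M) \<le> ennreal ((e * \<psi> p) powr p)"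
      if n: "n \<ge> K" and p: "p \<in> exponents a b" for n p
    proof -
      have p1: "1 \<le> p" by (rule exponents_ge_one[OF a p])
      \<comment> \<open>Fatou's lemma, with \<open>n\<close> fixed and the subsequence running.\<close>
      have "AE x in M. ennreal (\<bar>f n x - g x\<bar> powr p) =
          liminf (\<lambda>k. ennreal (\<bar>f n x - f (r k) x\<bar> powr p))"
        using lim
      proof eventually_elim
        case (elim x)
        have "(\<lambda>k. ennreal (\<bar>f n x - f (r k) x\<bar> powr p)) \<longlonglongrightarrow> ennreal (\<bar>f n x - g x\<bar> powr p)"
          using elim p1 by (intro tendsto_ennrealI tendsto_powr2 tendsto_intros) auto
        then show ?case by (rule lim_imp_Liminf[OF sequentially_bot, symmetric])
      qed
      then have "(\<integral>\<^sup>+x. ennreal (\<bar>f n x - g x\<bar> powr p) \<partial>M) =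
          (\<integral>\<^sup>+x. liminf (\<lambda>k. ennreal (\<bar>f n x - f (r k) x\<bar> powr p)) \<partial>M)"
        by (rule nn_integral_cong_AE)
      also have "\<dots> \<le> liminf (\<lambda>k. \<integral>\<^sup>+x. ennreal (\<bar>f n x - f (r k) x\<bar> powr p) \<partial>M)"
        by (rule nn_integral_liminf) measurable
      also have "\<dots> \<le> limsup (\<lambda>k. \<integral>\<^sup>+x. ennreal (\<bar>f n x - f (r k) x\<bar> powr p) \<partial>M)"
        by (rule Liminf_le_Limsup) simp
      also have "\<dots> \<le> ennreal ((e * \<psi> p) powr p)"
        using K[OF n _ p] r(3) by (intro Limsup_bounded eventually_sequentiallyI[of K]) (meson le_trans)
      finally show ?thesis .
    qed
    then show ?thesis using e by (auto simp: G_norm_le_iff[OF a \<psi>])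
  qed
  \<comment> \<open>Finiteness of the norm of \<open>g = f n - (f n - g)\<close> comes from a single close \<open>f n\<close>.\<close>
  have "g \<in> G_funs M a b \<psi>"
  proof -
    obtain n where n: "G_norm M a b \<psi> (\<lambda>x. f n x - g x) \<le> ennreal 1"
      using close[of 1] by auto
    have "(\<lambda>x. f n x - g x) \<in> G_funs M a b \<psi>"
      using le_less_trans[OF n] by (simp add: G_funs_def)
    from G_funs_diff[OF a \<psi> f[of n] this] show ?thesis by simp
  qed
  moreover have "(\<lambda>n. enn2real (G_norm M a b \<psi> (\<lambda>x. f n x - g x))) \<longlonglongrightarrow> 0"
  proof (rule LIMSEQ_I)
    fix e :: real assume e: "0 < e"
    obtain K where K: "\<And>n. n \<ge> K \<Longrightarrow> G_norm M a b \<psi> (\<lambda>x. f n x - g x) \<le> ennreal (e / 2)"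
      using close[of "e / 2"] e by auto
    have "norm (enn2real (G_norm M a b \<psi> (\<lambda>x. f n x - g x)) - 0) < e" if "n \<ge> K" for n
      using enn2real_leI[OF _ K[OF that]] e by simp
    then show "\<exists>K. \<forall>n\<ge>K. norm (enn2real (G_norm M a b \<psi> (\<lambda>x. f n x - g x)) - 0) < e" by blast
  qed
  ultimately show ?thesis by (rule that)
qed

section \<open>Passage to classes\<close>

abbreviation ae_class :: "'a measure \<Rightarrow> ('a \<Rightarrow> real) \<Rightarrow> ('a \<Rightarrow> real) set" where
  "ae_class M f \<equiv> ae_rel M `` {f}"

lemma G_space_cases:
  assumes "F \<in> G_space M a b \<psi>"
  obtains f where "f \<in> G_funs M a b \<psi>" "f \<in> borel_measurable M" "F = ae_class M f"
  using assms by (auto simp: G_space_def G_funs_def elim!: quotientE)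

lemma ae_class_in_G_space: "f \<in> G_funs M a b \<psi> \<Longrightarrow> ae_class M f \<in> G_space M a b \<psi>"
  unfolding G_space_def by (rule quotientI)

lemma ae_class_eq_zero_iff:
  assumes "f \<in> borel_measurable M"
  shows "ae_class M f = class_zero M \<longleftrightarrow> (AE x in M. f x = 0)"
  unfolding class_zero_def
  using assms by (subst eq_equiv_class_iff[OF equiv_ae_rel]) (auto simp: ae_rel_def)

theorem theorem1:
  fixes M :: "'a measure" and a :: real and b :: ereal and \<psi> :: "real \<Rightarrow> real"
  assumes "sigma_finite_measure M"
    and "emeasure M (space M) \<noteq> 0"
    and "emeasure M (space M) = 1 \<or> emeasure M (space M) = \<infinity>"
    and "diffuse M"
    and "1 \<le> a" and "ereal a < b"
    and "\<psi> \<in> U_Psi a b"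
    and "blows_up a b \<psi>"
  shows "banach_space_on (G_space M a b \<psi>) (class_add M) (class_zero M) (class_scale M)
           (class_norm M a b \<psi>)"
proof -
  note add = G_funs_add[OF assms(5,7)] and scale = G_funs_scale[OF assms(5,7)]
    and zero = G_funs_zero[OF assms(5,6,7)]
  note class_simps = class_add_eq class_scale_eq class_norm_eq
  show ?thesis
  proof
    fix F assume "F \<in> G_space M a b \<psi>"
    then obtain f where f: "f \<in> G_funs M a b \<psi>"
      and [measurable]: "f \<in> borel_measurable M" and F: "F = ae_class M f"
      by (rule G_space_cases)
    show "class_scale M c F \<in> G_space M a b \<psi>" for c
      using scale(1)[OF f] by (simp add: F class_simps ae_class_in_G_space)
    show "class_add M F (class_zero M) = F"
      by (simp add: F class_zero_def class_simps)
    show "\<exists>H\<in>G_space M a b \<psi>. class_add M F H = class_zero M"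
    proof
      show "ae_class M (\<lambda>x. - 1 * f x) \<in> G_space M a b \<psi>"
        by (rule ae_class_in_G_space[OF scale(1)[OF f]])
      show "class_add M F (ae_class M (\<lambda>x. - 1 * f x)) = class_zero M"
        by (simp add: F class_zero_def class_simps)
    qed
    show "class_scale M (c + d) F = class_add M (class_scale M c F) (class_scale M d F)" for c d
      by (simp add: F class_simps distrib_right)
    show "class_scale M c (class_scale M d F) = class_scale M (c * d) F" for c d
      by (simp add: F class_simps mult.assoc)
    show "class_scale M 1 F = F"
      by (simp add: F class_simps)
    show "0 \<le> class_norm M a b \<psi> F"
      by (simp add: F class_simps)
    show "class_norm M a b \<psi> F = 0 \<longleftrightarrow> F = class_zero M"
      using f G_norm_eq_zero_iff[OF assms(5,6,7), of f M]
      by (auto simp: F class_simps ae_class_eq_zero_iff enn2real_eq_0_iff G_funs_def)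
    show "class_norm M a b \<psi> (class_scale M c F) = \<bar>c\<bar> * class_norm M a b \<psi> F" for c
      using scale(2)[OF f] by (simp add: F class_simps)
    fix H assume "H \<in> G_space M a b \<psi>"
    then obtain h where h: "h \<in> G_funs M a b \<psi>"
      and [measurable]: "h \<in> borel_measurable M" and H: "H = ae_class M h"
      by (rule G_space_cases)
    show "class_add M F H \<in> G_space M a b \<psi>"
      using add(1)[OF f h] by (simp add: F H class_simps ae_class_in_G_space)
    show "class_add M F H = class_add M H F"
      by (simp add: F H class_simps add.commute)
    show "class_scale M c (class_add M F H) = class_add M (class_scale M c F) (class_scale M c H)" for c
      by (simp add: F H class_simps distrib_left)
    show "class_norm M a b \<psi> (class_add M F H) \<le> class_norm M a b \<psi> F + class_norm M a b \<psi> H"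
      using add(2)[OF f h] by (simp add: F H class_simps)
    fix K assume "K \<in> G_space M a b \<psi>"
    then obtain k where [measurable]: "k \<in> borel_measurable M" and K: "K = ae_class M k"
      by (rule G_space_cases)
    show "class_add M (class_add M F H) K = class_add M F (class_add M H K)"
      by (simp add: F H K class_simps add.assoc)
  next
    show "class_zero M \<in> G_space M a b \<psi>"
      unfolding class_zero_def by (rule ae_class_in_G_space[OF zero])
  next
    fix s :: "nat \<Rightarrow> ('a \<Rightarrow> real) set"
    assume s: "\<And>n. s n \<in> G_space M a b \<psi>"
      and Cauchy: "\<And>e. 0 < e \<Longrightarrow> \<exists>N. \<forall>m\<ge>N. \<forall>n\<ge>N.
        class_norm M a b \<psi> (class_add M (s m) (class_scale M (- 1) (s n))) < e"
    have "\<exists>f. f \<in> G_funs M a b \<psi> \<and> f \<in> borel_measurable M \<and> s n = ae_class M f" for n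
      using G_space_cases[OF s[of n]] by metis
    then obtain f where f: "\<And>n. f n \<in> G_funs M a b \<psi>"
      and meas [measurable]: "\<And>n. f n \<in> borel_measurable M" and sf: "\<And>n. s n = ae_class M (f n)"
      by metis
    have dist: "class_norm M a b \<psi> (class_add M (s n) (class_scale M (- 1) (ae_class M g))) =
        enn2real (G_norm M a b \<psi> (\<lambda>x. f n x - g x))" if [measurable]: "g \<in> borel_measurable M" for n g
      by (simp add: sf class_simps)
    have "\<exists>N. \<forall>m\<ge>N. \<forall>n\<ge>N. enn2real (G_norm M a b \<psi> (\<lambda>x. f m x - f n x)) < e" if "0 < e" for e
      using Cauchy[OF that] by (simp only: sf[symmetric] dist[OF meas, folded sf])
    then obtain g where g: "g \<in> G_funs M a b \<psi>"
      and lim: "(\<lambda>n. enn2real (G_norm M a b \<psi> (\<lambda>x. f n x - g x))) \<longlonglongrightarrow> 0"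
      by (rule G_funs_Cauchy_imp_limit[OF assms(5,6,7) f])
    have "g \<in> borel_measurable M" using g by (simp add: G_funs_def)
    then show "\<exists>G\<in>G_space M a b \<psi>.
        (\<lambda>n. class_norm M a b \<psi> (class_add M (s n) (class_scale M (- 1) G))) \<longlonglongrightarrow> 0"
      using lim by (intro bexI[OF _ ae_class_in_G_space[OF g]]) (simp add: dist)
  qed
qed

end
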